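(* Assume that $(H_1)$, $(H_1^{\mathcal B})$ and $(H_2^{\mathcal B})$ (as stated in the context) hold, with activation functions $g_i$ of class $\mathcal B$. Then for each $\Sigma=(\varsigma_1,\dots,\varsigma_N)\in\{1,2\}^N$ the set $\mathcal K^\Sigma$ is positively invariant for the solution flow of the network (GNN): for every $\phi\in\mathcal K^\Sigma$ one has $u_t(\cdot;\phi)\in\mathcal K^\Sigma$ for all $t\ge 0$.
   Context: **System.** Let $N,M\ge1$ be integers; indices satisfy $i,j\in\{1,\dots,N\}$, $l\in\{1,\dots,M\}$. The general neural network (GNN) is $$\frac{du^i(t)}{dt}=-c_i(t)u^i(t)+\sum_{l=1}^M\sum_{j=1}^N a_{ijl}(t)\,g_j\big(\sigma_j u^j(t-\kappa_{ijl}(t))\big)+J_i(t),\qquad i=1,\dots,N. \tag{GNN}$$ The delays satisfy $0<\kappa_{ijl}(t)\le\kappa_{ijl}$ with constants $\kappa_{ijl}$, and $\kappa:=\max_{i,j,l}\kappa_{ijl}$. For $\phi\in C([-\kappa,0],\mathbb R^N)$, $u(t;\phi)$ denotes the solution of (GNN) for $t\ge0$ with $u(s;\phi)=\phi(s)$ on $[-\kappa,0]$, and $u_t(s;\phi)=u(t+s;\phi)$, $s\in[-\kappa,0]$. **Almost periodic** is in the sense of Bohr: a continuous $f:\mathbb R\to\mathbb R$ such that for each $\epsilon>0$ the set $\{T:|f(t+T)-f(t)|<\epsilon\ \forall t\in\mathbb R\}$ is relatively dense. **$(H_1)$**: $c_i(t)>0$, $a_{ijl}(t)$, $\kappa_{ijl}(t)>0$,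 $J_i(t)$ are almost periodic functions on $\mathbb R$; $\sigma_j>0$ are constants; $a_{iil}(t)>0$. **Class $\mathcal B$**: $g_j:\mathbb R\to\mathbb R$ is continuous with $g_j(x)=u_{j1}$ for $x<\ell_{j1}$, $g_j(x)=\tilde g_j(x)$ for $\ell_{j1}\le x\le\ell_{j2}$, $g_j(x)=u_{j2}$ for $x>\ell_{j2}$, where $\tilde g_j$ is a $C^1$ increasing function with $\tilde g_j(0)=0$, and $\ell_{j1}<0<\ell_{j2}$, $-\infty<u_{j1}<0<u_{j2}<+\infty$ are constants. Write $U_j:=\max\{|u_{j1}|,|u_{j2}|\}$. **Auxiliary functions**: $F_i(z)=-\big(\sup_{t}c_i(t)\big)z+\big(\inf_{t}\sum_{l=1}^M a_{iil}(t)\big)g_i(\sigma_i z)$. All $\sup$ and $\inf$ over $t$ are over $t\in\mathbb R$. **$(H_1^{\mathcal B})$**: for every $i$ and every $\zeta\in[\ell_{i1},\ell_{i2}]$, $\ \sup_tc_i(t)<\big(\inf_t\sum_{l=1}^Ma_{iil}(t)\big)\sigma_i\dot{\tilde g}_i(\zeta)$. **$(H_2^{\mathcal B})$**: for every $i$, $k=1,2$ and all $t\in\mathbb R$, $$(-1)^k\Big\{-\sup_tc_i(t)\frac{\ell_{ik}}{\sigma_i}+\Big(\inf_t\sum_{l=1}^Ma_{iil}(t)\Big)u_{ik}+J_i(t)\Big\}>\sum_{l=1}^M\sum_{j\ne i}\sup_t|a_{ijl}(t)|\,U_j .$$ **Basins**: $\beta_{i1}:=\hat\ell_{i1}$ is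 the point $\hat\ell_{i1}<\ell_{i1}/\sigma_i$ with $F_i(\hat\ell_{i1})+\sum_l\sum_{j\ne i}\sup_t|a_{ijl}(t)|U_j+\sup_tJ_i(t)=0$; $\alpha_{i2}:=\tilde\ell_{i2}$ is the point $\tilde\ell_{i2}>\ell_{i2}/\sigma_i$ with $F_i(\tilde\ell_{i2})-\sum_l\sum_{j\ne i}\sup_t|a_{ijl}(t)|U_j+\inf_tJ_i(t)=0$. Set $$\mathcal K_{i1}=\{\psi\in C([-\kappa,0],\mathbb R):\psi(s)\le\beta_{i1}\ \forall s\},\qquad \mathcal K_{i2}=\{\psi\in C([-\kappa,0],\mathbb R):\psi(s)\ge\alpha_{i2}\ \forall s\},$$ and $\mathcal K^\Sigma=\mathcal K_{1\varsigma_1}\times\cdots\times\mathcal K_{N\varsigma_N}$ for $\Sigma=(\varsigma_1,\dots,\varsigma_N)\in\{1,2\}^N$. *)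

theory Defs
  imports "HOL-Analysis.Analysis"
begin

definition relatively_dense :: "real set \<Rightarrow> bool" where
  "relatively_dense A \<longleftrightarrow> (\<exists>L>0. \<forall>x. \<exists>T\<in>A. x \<le> T \<and> T \<le> x + L)"

definition almost_periodic :: "(real \<Rightarrow> real) \<Rightarrow> bool" where
  "almost_periodic f \<longleftrightarrow> continuous_on UNIV f \<and>
     (\<forall>\<epsilon>>0. relatively_dense {T. \<forall>t. \<bar>f (t + T) - f t\<bar> < \<epsilon>})"

(* Data of a network. The finite types 'n and 'm index the N >= 1 neurons and the M >= 1
   interconnection terms. The natural-number argument of ell and sat is the index k, 1 or 2. *)
record ('n, 'm) gnn =
  decay :: "'n \<Rightarrow> real \<Rightarrow> real"                       (* c_i(t) *)
  weight :: "'n \<Rightarrow> 'n \<Rightarrow> 'm \<Rightarrow> real \<Rightarrow> real"          (* a_ijl(t) *)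
  delay :: "'n \<Rightarrow> 'n \<Rightarrow> 'm \<Rightarrow> real \<Rightarrow> real"           (* kappa_ijl(t) *)
  delay_bound :: "'n \<Rightarrow> 'n \<Rightarrow> 'm \<Rightarrow> real"            (* the constants kappa_ijl *)
  input :: "'n \<Rightarrow> real \<Rightarrow> real"                       (* J_i(t) *)
  gain :: "'n \<Rightarrow> real"                               (* sigma_j *)
  act :: "'n \<Rightarrow> real \<Rightarrow> real"                         (* g_j *)
  core :: "'n \<Rightarrow> real \<Rightarrow> real"                        (* g_j with a tilde *)
  ell :: "'n \<Rightarrow> nat \<Rightarrow> real"                         (* ell_jk *)
  sat :: "'n \<Rightarrow> nat \<Rightarrow> real"                         (* u_jk *)

definition delay_bounds :: "('n::finite, 'm::finite) gnn \<Rightarrow> bool" where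
  "delay_bounds S \<longleftrightarrow> (\<forall>i j l t. 0 < delay S i j l t \<and> delay S i j l t \<le> delay_bound S i j l)"

definition max_delay :: "('n::finite, 'm::finite) gnn \<Rightarrow> real" where
  "max_delay S = Max {delay_bound S i j l | i j l. True}"

definition H1 :: "('n::finite, 'm::finite) gnn \<Rightarrow> bool" where
  "H1 S \<longleftrightarrow>
     (\<forall>i. almost_periodic (decay S i) \<and> (\<forall>t. decay S i t > 0)) \<and>
     (\<forall>i j l. almost_periodic (weight S i j l)) \<and>
     (\<forall>i j l. almost_periodic (delay S i j l) \<and> (\<forall>t. delay S i j l t > 0)) \<and>
     (\<forall>i. almost_periodic (input S i)) \<and>
     (\<forall>j. gain S j > 0) \<and>
     (\<forall>i l t. weight S i i l t > 0)"

(* The core function matters only on [ell_j1, ell_j2]; its derivatives are one-sided at the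
   two endpoints. *)
definition class_B :: "('n::finite, 'm::finite) gnn \<Rightarrow> 'n \<Rightarrow> bool" where
  "class_B S j \<longleftrightarrow>
     ell S j 1 < 0 \<and> 0 < ell S j 2 \<and> sat S j 1 < 0 \<and> 0 < sat S j 2 \<and>
     continuous_on UNIV (act S j) \<and>
     (\<forall>x. x < ell S j 1 \<longrightarrow> act S j x = sat S j 1) \<and>
     (\<forall>x\<in>{ell S j 1..ell S j 2}. act S j x = core S j x) \<and>
     (\<forall>x. x > ell S j 2 \<longrightarrow> act S j x = sat S j 2) \<and>
     (\<exists>D. continuous_on {ell S j 1..ell S j 2} D \<and>
        (\<forall>x\<in>{ell S j 1..ell S j 2}.
           (core S j has_real_derivative D x) (at x within {ell S j 1..ell S j 2}))) \<and>
     mono_on {ell S j 1..ell S j 2} (core S j) \<and>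
     core S j 0 = 0"

definition U_max :: "('n::finite, 'm::finite) gnn \<Rightarrow> 'n \<Rightarrow> real" where
  "U_max S j = max \<bar>sat S j 1\<bar> \<bar>sat S j 2\<bar>"

definition self_inf :: "('n::finite, 'm::finite) gnn \<Rightarrow> 'n \<Rightarrow> real" where
  "self_inf S i = (INF t. \<Sum>l\<in>UNIV. weight S i i l t)"

definition cross_bound :: "('n::finite, 'm::finite) gnn \<Rightarrow> 'n \<Rightarrow> real" where
  "cross_bound S i = (\<Sum>l\<in>UNIV. \<Sum>j\<in>UNIV - {i}. (SUP t. \<bar>weight S i j l t\<bar>) * U_max S j)"

definition F :: "('n::finite, 'm::finite) gnn \<Rightarrow> 'n \<Rightarrow> real \<Rightarrow> real" where
  "F S i z = - (SUP t. decay S i t) * z + self_inf S i * act S i (gain S i * z)"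

definition H1_B :: "('n::finite, 'm::finite) gnn \<Rightarrow> bool" where
  "H1_B S \<longleftrightarrow> (\<forall>i. \<forall>\<zeta>\<in>{ell S i 1..ell S i 2}.
     (SUP t. decay S i t) <
     self_inf S i * gain S i *
       vector_derivative (core S i) (at \<zeta> within {ell S i 1..ell S i 2}))"

definition H2_B :: "('n::finite, 'm::finite) gnn \<Rightarrow> bool" where
  "H2_B S \<longleftrightarrow> (\<forall>i. \<forall>k\<in>{1, 2}. \<forall>t.
     (-1) ^ k * (- (SUP t. decay S i t) * (ell S i k / gain S i)
                 + self_inf S i * sat S i k + input S i t) > cross_bound S i)"

(* On each outer half-line F S i is affine with slope - (SUP t. decay S i t) < 0, so is_beta and
   is_alpha each determine at most one point. If the supremum (infimum) of the input is not
   attained, the pointwise strict inequality H2_B still allows this point to degenerate to the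
   endpoint ell S i k / gain S i, and then no point satisfies the strict condition. *)
definition is_beta :: "('n::finite, 'm::finite) gnn \<Rightarrow> 'n \<Rightarrow> real \<Rightarrow> bool" where
  "is_beta S i z \<longleftrightarrow> z < ell S i 1 / gain S i \<and>
     F S i z + cross_bound S i + (SUP t. input S i t) = 0"

definition is_alpha :: "('n::finite, 'm::finite) gnn \<Rightarrow> 'n \<Rightarrow> real \<Rightarrow> bool" where
  "is_alpha S i z \<longleftrightarrow> z > ell S i 2 / gain S i \<and>
     F S i z - cross_bound S i + (INF t. input S i t) = 0"

(* Elements of C([-kappa,0], _) are represented by total functions; only their values on
   [-kappa,0] are constrained. *)
definition K1 :: "('n::finite, 'm::finite) gnn \<Rightarrow> real \<Rightarrow> (real \<Rightarrow> real) set" where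
  "K1 S b = {\<psi>. continuous_on {- max_delay S..0} \<psi> \<and> (\<forall>s\<in>{- max_delay S..0}. \<psi> s \<le> b)}"

definition K2 :: "('n::finite, 'm::finite) gnn \<Rightarrow> real \<Rightarrow> (real \<Rightarrow> real) set" where
  "K2 S a = {\<psi>. continuous_on {- max_delay S..0} \<psi> \<and> (\<forall>s\<in>{- max_delay S..0}. a \<le> \<psi> s)}"

definition K_Sigma ::
  "('n::finite, 'm::finite) gnn \<Rightarrow> ('n \<Rightarrow> real) \<Rightarrow> ('n \<Rightarrow> real) \<Rightarrow> ('n \<Rightarrow> nat)
     \<Rightarrow> (real \<Rightarrow> real ^ 'n) set" where
  "K_Sigma S \<beta> \<alpha> sig =
     {\<phi>. \<forall>i. (\<lambda>s. \<phi> s $ i) \<in> (if sig i = 1 then K1 S (\<beta> i) else K2 S (\<alpha> i))}"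

definition gnn_rhs ::
  "('n::finite, 'm::finite) gnn \<Rightarrow> (real \<Rightarrow> real ^ 'n) \<Rightarrow> 'n \<Rightarrow> real \<Rightarrow> real" where
  "gnn_rhs S u i t = - decay S i t * u t $ i
     + (\<Sum>l\<in>UNIV. \<Sum>j\<in>UNIV.
          weight S i j l t * act S j (gain S j * u (t - delay S i j l t) $ j))
     + input S i t"

(* The derivative at t = 0 is the right-hand one. *)
definition is_solution ::
  "('n::finite, 'm::finite) gnn \<Rightarrow> (real \<Rightarrow> real ^ 'n) \<Rightarrow> (real \<Rightarrow> real ^ 'n) \<Rightarrow> bool" where
  "is_solution S \<phi> u \<longleftrightarrow>
     continuous_on {- max_delay S..} u \<and>
     (\<forall>s\<in>{- max_delay S..0}. u s = \<phi> s) \<and>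
     (\<forall>t\<ge>0. \<forall>i. ((\<lambda>r. u r $ i) has_real_derivative gnn_rhs S u i t) (at t within {0..}))"

definition positively_invariant ::
  "('n::finite, 'm::finite) gnn \<Rightarrow> (real \<Rightarrow> real ^ 'n) set \<Rightarrow> bool" where
  "positively_invariant S A \<longleftrightarrow>
     (\<forall>\<phi>\<in>A. \<forall>u. is_solution S \<phi> u \<longrightarrow> (\<forall>t\<ge>0. (\<lambda>s. u (t + s)) \<in> A))"

end

theory Submission imports Defs
begin

text \<open>
  Fix a component with \<open>sig i = 1\<close> (the other case is its mirror image). As long as
  \<open>u\<^sup>i\<close> has stayed below \<open>ell S i 1 / gain S i\<close>, the self-feedback is saturated at
  \<open>sat S i 1\<close> and all other terms are bounded uniformly, so the equation defining
  \<open>\<beta> i\<close> yields \<open>v' \<le> C (\<beta> i - v)\<close> with \<open>v = u\<^sup>i\<close> and \<open>C\<close> the supremum of the decay rate.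
  Hence \<open>(v - \<beta> i) exp (C t)\<close> is nonincreasing, so \<open>v\<close> never exceeds \<open>\<beta> i\<close>, and the
  threshold is never reached.
\<close>

text \<open>An almost period for tolerance 1 moves any \<open>t\<close> into the compact interval
  \<open>{0..L}\<close>, where continuity bounds \<open>f\<close>; the move changes the value by
  less than 1.\<close>

lemma almost_periodic_bounded:
  assumes "almost_periodic f"
  obtains B where "\<And>t. \<bar>f t\<bar> \<le> B"
proof -
  have "relatively_dense {T. \<forall>t. \<bar>f (t + T) - f t\<bar> < 1}"
    using assms unfolding almost_periodic_def by simp
  then obtain L where L: "\<And>x. \<exists>T. (\<forall>t. \<bar>f (t + T) - f t\<bar> < 1) \<and> x \<le> T \<and> T \<le> x + L"
    unfolding relatively_dense_def by blast
  have "continuous_on {0..L} f"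
    using assms continuous_on_subset unfolding almost_periodic_def by blast
  then have "bounded (f ` {0..L})"
    by (intro compact_imp_bounded compact_continuous_image) auto
  then obtain B where "\<forall>y\<in>f ` {0..L}. norm y \<le> B"
    unfolding bounded_iff by (rule exE)
  then have B: "\<bar>f s\<bar> \<le> B" if "s \<in> {0..L}" for s
    using that by simp
  have "\<bar>f t\<bar> \<le> B + 1" for t
  proof -
    obtain T where T: "\<bar>f (t + T) - f t\<bar> < 1" "- t \<le> T" "T \<le> - t + L"
      using L[of "- t"] by blast
    then have "\<bar>f (t + T)\<bar> \<le> B" by (intro B) auto
    then show ?thesis using T(1) by linarith
  qed
  then show thesis by (rule that)
qed

text \<open>These bounds make each \<open>SUP\<close> and \<open>INF\<close> of a coefficient over
  the real line a genuine bound on its values.\<close>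

lemma almost_periodic_bdd:
  assumes "almost_periodic f"
  shows "bdd_above (range f)" "bdd_below (range f)" "bdd_above (range (\<lambda>t. \<bar>f t\<bar>))"
proof -
  obtain B where B: "\<And>t. \<bar>f t\<bar> \<le> B" using almost_periodic_bounded[OF assms] by blast
  have "f t \<le> B" "- B \<le> f t" for t using B[of t] by linarith+
  then show "bdd_above (range f)" "bdd_below (range f)" "bdd_above (range (\<lambda>t. \<bar>f t\<bar>))"
    using B by (auto intro!: bdd_aboveI[where M = B] bdd_belowI[where m = "- B"])
qed

text \<open>With the integrating factor \<open>exp (C * s)\<close>, the product
  \<open>(v s - b) * exp (C * s)\<close> has derivative
  \<open>(D s + C * (v s - b)) * exp (C * s)\<close>, which is nonpositive. The inequality is asked
  for only inside the interval, so \<open>t\<close> may be the very time at which a barrier is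
  hit.\<close>

lemma exp_comparison:
  fixes v D :: "real \<Rightarrow> real"
  assumes "0 \<le> t" and "continuous_on {0..t} v" and "v 0 \<le> b"
    and deriv: "\<And>s. 0 < s \<Longrightarrow> s < t \<Longrightarrow> (v has_real_derivative D s) (at s)"
    and decr: "\<And>s. 0 < s \<Longrightarrow> s < t \<Longrightarrow> D s \<le> C * (b - v s)"
  shows "v t \<le> b"
proof -
  define w where "w = (\<lambda>s. (v s - b) * exp (C * s))"
  have "w t \<le> w 0"
  proof (rule DERIV_nonpos_imp_decreasing_open[OF \<open>0 \<le> t\<close>])
    show "continuous_on {0..t} w"
      unfolding w_def by (intro continuous_intros assms)
    fix s assume s: "0 < s" "s < t"
    have "(w has_real_derivative (D s + C * (v s - b)) * exp (C * s)) (at s)"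
      unfolding w_def
      by (auto intro!: derivative_eq_intros deriv[OF s] simp: algebra_simps)
    moreover have "D s + C * (v s - b) \<le> 0"
      using decr[OF s] by (simp add: algebra_simps)
    ultimately show "\<exists>y. (w has_real_derivative y) (at s) \<and> y \<le> 0"
      by (meson exp_ge_zero mult_nonpos_nonneg)
  qed
  then have "(v t - b) * exp (C * t) \<le> 0" using \<open>v 0 \<le> b\<close> by (simp add: w_def)
  then show ?thesis by (simp add: mult_le_0_iff)
qed

text \<open>The differential inequality is available only while the whole history lies below
  \<open>m\<close>. The gap \<open>b < m\<close> closes this circle: up to a first contact with
  \<open>m\<close> the comparison applies and forces \<open>v\<close> to be at most \<open>b\<close>
  there, so no contact occurs.\<close>

lemma delayed_barrier:
  fixes v D :: "real \<Rightarrow> real"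
  assumes "0 \<le> r" and cont: "continuous_on {- r..} v" and "b < m"
    and init: "\<And>s. s \<in> {- r..0} \<Longrightarrow> v s \<le> b"
    and deriv: "\<And>s. 0 < s \<Longrightarrow> (v has_real_derivative D s) (at s)"
    and decr: "\<And>s. 0 < s \<Longrightarrow> (\<And>x. x \<in> {- r..s} \<Longrightarrow> v x < m) \<Longrightarrow> D s \<le> C * (b - v s)"
    and "- r \<le> t"
  shows "v t \<le> b"
proof -
  have v0: "v 0 \<le> b" using init \<open>0 \<le> r\<close> by simp
  have cont0: "continuous_on {0..x} v" for x
    using cont by (rule continuous_on_subset) (use \<open>0 \<le> r\<close> in auto)
  have below: "v x < m" if x: "- r \<le> x" for x
  proof (rule ccontr)
    assume "\<not> v x < m"
    \<comment> \<open>\<open>H\<close> collects the contact times up to \<open>x\<close>;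
      compactness provides the earliest one, \<open>T\<close>.\<close>
    define H where "H = {0..x} \<inter> v -` {m..}"
    have "x > 0" using init[of x] x \<open>b < m\<close> \<open>\<not> v x < m\<close> by force
    then have "x \<in> H" using \<open>\<not> v x < m\<close> by (simp add: H_def)
    moreover have "compact H"
      unfolding H_def using cont0
      by (intro compact_eq_bounded_closed[THEN iffD2] conjI bounded_Int
          continuous_closed_preimage) auto
    ultimately obtain T where T: "T \<in> H" "\<And>y. y \<in> H \<Longrightarrow> T \<le> y"
      using compact_attains_inf[of H] by blast
    \<comment> \<open>Strictly before \<open>T\<close> the history stays below the barrier, so
      \<open>decr\<close> holds on the open interval from 0 to \<open>T\<close>.\<close>
    have "v y < m" if "y \<in> {- r..<T}" for y
    proof (cases "y \<le> 0")
      case True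
      then show ?thesis using init[of y] that \<open>b < m\<close> by force
    next
      case False
      moreover have "y \<notin> H" using T(2)[of y] that by auto
      ultimately show ?thesis using T(1) that by (auto simp: H_def)
    qed
    then have "v T \<le> b"
      using T(1) by (intro exp_comparison[OF _ cont0 v0 deriv decr]) (auto simp: H_def)
    then show False using T(1) \<open>b < m\<close> by (simp add: H_def)
  qed
  show ?thesis
  proof (cases "t \<le> 0")
    case True
    then show ?thesis using init \<open>- r \<le> t\<close> by simp
  next
    case False
    then show ?thesis
      by (intro exp_comparison[OF _ cont0 v0 deriv decr]) (auto intro: below)
  qed
qed

text \<open>Continuity forces the core to meet the saturation values at both ends of its interval,
  and monotonicity keeps it between them.\<close>

lemma class_B_act_bounds:
  assumes "class_B S j"
  shows "act S j x \<in> {sat S j 1..sat S j 2}"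
proof -
  let ?a = "ell S j 1" and ?b = "ell S j 2"
  have ab: "?a < 0" "0 < ?b" "sat S j 1 < 0" "0 < sat S j 2"
    and cont: "continuous_on UNIV (act S j)"
    and lo: "\<And>x. x < ?a \<Longrightarrow> act S j x = sat S j 1"
    and mid: "\<And>x. x \<in> {?a..?b} \<Longrightarrow> act S j x = core S j x"
    and hi: "\<And>x. x > ?b \<Longrightarrow> act S j x = sat S j 2"
    and mono: "mono_on {?a..?b} (core S j)"
    using assms unfolding class_B_def by auto
  have lim: "(act S j \<longlongrightarrow> act S j y) (at y within A)" for y A
    by (rule tendsto_within_subset[OF _ subset_UNIV]) (use cont in \<open>simp add: continuous_on_def\<close>)
  \<comment> \<open>Left of \<open>?a\<close> the activation is constant, and its left limit is its
    value at \<open>?a\<close>; uniqueness of limits identifies the two.\<close>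
  have "((\<lambda>_. sat S j 1) \<longlongrightarrow> act S j ?a) (at_left ?a)"
    by (rule Lim_transform_eventually[OF lim]) (simp add: eventually_at_filter lo)
  then have a: "act S j ?a = sat S j 1" by (simp add: tendsto_const_iff)
  have "((\<lambda>_. sat S j 2) \<longlongrightarrow> act S j ?b) (at_right ?b)"
    by (rule Lim_transform_eventually[OF lim]) (simp add: eventually_at_filter hi)
  then have b: "act S j ?b = sat S j 2" by (simp add: tendsto_const_iff)
  consider "x < ?a" | "x \<in> {?a..?b}" | "x > ?b" by fastforce
  then show ?thesis
  proof cases
    case 2
    then have "core S j ?a \<le> core S j x" "core S j x \<le> core S j ?b"
      using ab by (auto intro!: mono_onD[OF mono])
    then show ?thesis using 2 ab a b mid[of x] mid[of ?a] mid[of ?b] by simp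
  qed (use lo hi ab in auto)
qed

lemma max_delay_ge: "delay_bound S i j l \<le> max_delay S"
proof -
  have "{delay_bound S i j l | i j l. True} = range (\<lambda>(i, j, l). delay_bound S i j l)"
    by (simp add: full_SetCompr_eq image_def)
  then have "finite {delay_bound S i j l | i j l. True}" by simp
  then show ?thesis unfolding max_delay_def by (rule Max_ge) blast
qed

text \<open>Splitting off the terms with \<open>j = i\<close> leaves the coupling to other neurons,
  estimated term by term regardless of the state. The absolute value serves the upper estimate for
  \<open>sig i = 1\<close> and the lower one for \<open>sig i = 2\<close>.\<close>

lemma gnn_rhs_bound:
  assumes "H1 S" and "\<And>j. class_B S j"
  shows "\<bar>gnn_rhs S u i t - (- decay S i t * u t $ i
      + (\<Sum>l\<in>UNIV. weight S i i l t * act S i (gain S i * u (t - delay S i i l t) $ i))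
      + input S i t)\<bar> \<le> cross_bound S i"
proof -
  define h where "h = (\<lambda>l j. weight S i j l t * act S j (gain S j * u (t - delay S i j l t) $ j))"
  have h: "\<bar>h l j\<bar> \<le> (SUP t. \<bar>weight S i j l t\<bar>) * U_max S j" for l j
  proof -
    have "almost_periodic (weight S i j l)" using assms(1) unfolding H1_def by blast
    then have "\<bar>weight S i j l t\<bar> \<le> (SUP t. \<bar>weight S i j l t\<bar>)"
      by (intro cSUP_upper almost_periodic_bdd) auto
    moreover have "\<bar>act S j x\<bar> \<le> U_max S j" for x
      using class_B_act_bounds[OF assms(2), of j x] unfolding U_max_def by auto
    ultimately show ?thesis
      unfolding h_def abs_mult by (intro mult_mono') auto
  qed
  have "(\<Sum>l\<in>UNIV. \<Sum>j\<in>UNIV. h l j) = (\<Sum>l\<in>UNIV. h l i) + (\<Sum>l\<in>UNIV. \<Sum>j\<in>UNIV - {i}. h l j)"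
    by (simp add: sum.remove[of UNIV i] sum.distrib)
  moreover have "\<bar>\<Sum>l\<in>UNIV. \<Sum>j\<in>UNIV - {i}. h l j\<bar> \<le> cross_bound S i"
    unfolding cross_bound_def
    by (intro order_trans[OF sum_abs] sum_mono h)
  ultimately show ?thesis unfolding gnn_rhs_def h_def by simp
qed

theorem theorem5:
  fixes S :: "('n::finite, 'm::finite) gnn"
    and \<beta> \<alpha> :: "'n \<Rightarrow> real" and sig :: "'n \<Rightarrow> nat"
  assumes "delay_bounds S" and "H1 S" and "\<And>j. class_B S j" and "H1_B S" and "H2_B S"
    and "\<And>i. sig i \<in> {1, 2}"
    and "\<And>i. sig i = 1 \<Longrightarrow> is_beta S i (\<beta> i)"
    and "\<And>i. sig i = 2 \<Longrightarrow> is_alpha S i (\<alpha> i)"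
  shows "positively_invariant S (K_Sigma S \<beta> \<alpha> sig)"
  unfolding positively_invariant_def
proof (intro ballI allI impI)
  fix \<phi> u and t :: real
  assume \<phi>: "\<phi> \<in> K_Sigma S \<beta> \<alpha> sig" and u: "is_solution S \<phi> u" and "0 \<le> t"
  define r where "r = max_delay S"
  have delay: "0 < delay S i j l s" "delay S i j l s \<le> r" for i j l s
    using assms(1) order_trans[OF _ max_delay_ge[of S i j l]] unfolding delay_bounds_def r_def
    by simp_all
  \<comment> \<open>Index types are inhabited, so any one delay shows that \<open>r\<close> is
    positive.\<close>
  have "0 \<le> r" using delay[of undefined undefined undefined 0] by linarith
  have cont: "continuous_on {- r..} (\<lambda>s. u s $ i)" for i
    using u unfolding is_solution_def r_def by (intro continuous_on_component) simp
  have deriv: "((\<lambda>s. u s $ i) has_real_derivative gnn_rhs S u i s) (at s)" if "0 < s" for i s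
  proof -
    have "((\<lambda>s. u s $ i) has_real_derivative gnn_rhs S u i s) (at s within {0..})"
      using u that unfolding is_solution_def by simp
    then show ?thesis using that at_within_interior[of s "{0..}"] by simp
  qed
  have init: "u s $ i \<in> (if sig i = 1 then {..\<beta> i} else {\<alpha> i..})" if "s \<in> {- r..0}" for i s
  proof -
    have "(\<lambda>s. \<phi> s $ i) \<in> (if sig i = 1 then K1 S (\<beta> i) else K2 S (\<alpha> i))"
      using \<phi> unfolding K_Sigma_def by blast
    moreover have "u s = \<phi> s"
      using u that unfolding is_solution_def r_def by blast
    ultimately show ?thesis
      using that by (simp add: K1_def K2_def r_def split: if_split_asm)
  qed
  have decay: "0 < decay S i s" "decay S i s \<le> (SUP t. decay S i t)"
    and self: "self_inf S i \<le> (\<Sum>l\<in>UNIV. weight S i i l s)"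
    and input: "input S i s \<le> (SUP t. input S i t)" "(INF t. input S i t) \<le> input S i s"
    and gain: "0 < gain S i" for i s
  proof -
    show "0 < decay S i s" "0 < gain S i" using assms(2) unfolding H1_def by blast+
    have "almost_periodic (decay S i)" "almost_periodic (input S i)"
      using assms(2) unfolding H1_def by blast+
    then show "decay S i s \<le> (SUP t. decay S i t)" "input S i s \<le> (SUP t. input S i t)"
      "(INF t. input S i t) \<le> input S i s"
      by (auto intro: cSUP_upper cINF_lower almost_periodic_bdd)
    \<comment> \<open>Positive self-weights supply the lower bound that the infimum in
      \<open>self_inf\<close> requires.\<close>
    have "0 \<le> (\<Sum>l\<in>UNIV. weight S i i l t)" for t
      using assms(2) unfolding H1_def by (intro sum_nonneg) (auto intro: less_imp_le)
    then show "self_inf S i \<le> (\<Sum>l\<in>UNIV. weight S i i l s)"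
      unfolding self_inf_def by (intro cINF_lower bdd_belowI[where m = 0]) auto
  qed
  have "(\<lambda>s. u (t + s) $ i) \<in> (if sig i = 1 then K1 S (\<beta> i) else K2 S (\<alpha> i))" for i
  proof -
    have B: "ell S i 1 < 0" "0 < ell S i 2" "sat S i 1 < 0" "0 < sat S i 2"
      "\<And>x. x < ell S i 1 \<Longrightarrow> act S i x = sat S i 1"
      "\<And>x. x > ell S i 2 \<Longrightarrow> act S i x = sat S i 2"
      using assms(3)[of i] unfolding class_B_def by auto
    let ?C = "SUP t. decay S i t"
    \<comment> \<open>As \<open>t\<close> is nonnegative, the segment at time \<open>t\<close> only
      sees times from \<open>- r\<close> onwards; a bound on that half-line therefore settles
      membership.\<close>
    have shift: "continuous_on {- r..0} (\<lambda>s. u (t + s) $ i)"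
      by (rule continuous_on_compose2[OF cont]) (use \<open>0 \<le> t\<close> in \<open>auto intro: continuous_intros\<close>)
    consider "sig i = 1" | "sig i = 2" using assms(6)[of i] by auto
    then show ?thesis
    proof cases
      case 1
      \<comment> \<open>\<open>gain S i * \<beta> i\<close> lies in the left saturation range, so
        \<open>F\<close> is affine there and \<open>is_beta\<close> becomes a linear
        equation.\<close>
      have beta: "\<beta> i < ell S i 1 / gain S i"
        "- ?C * \<beta> i + self_inf S i * sat S i 1 + cross_bound S i + (SUP t. input S i t) = 0"
        using assms(7)[OF 1] B(5) gain[of i]
        unfolding is_beta_def F_def by (auto simp: field_simps)
      have "u x $ i \<le> \<beta> i" if "- r \<le> x" for x
      proof (rule delayed_barrier[OF \<open>0 \<le> r\<close> cont beta(1) _ deriv _ that])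
        show "u s $ i \<le> \<beta> i" if "s \<in> {- r..0}" for s
          using init[OF that, of i] 1 by simp
        fix s :: real
        assume s: "0 < s" and below: "\<And>x. x \<in> {- r..s} \<Longrightarrow> u x $ i < ell S i 1 / gain S i"
        \<comment> \<open>A delay between 0 and \<open>r\<close> puts the delayed time into
          \<open>{- r..s}\<close>, where the history is below the threshold.\<close>
        have "act S i (gain S i * u (s - delay S i i l s) $ i) = sat S i 1" for l
          using below[of "s - delay S i i l s"] delay[of i i l s] s gain[of i]
          by (intro B) (auto simp: field_simps)
        then have "gnn_rhs S u i s \<le> - decay S i s * u s $ i
            + (\<Sum>l\<in>UNIV. weight S i i l s) * sat S i 1 + input S i s + cross_bound S i"
          using gnn_rhs_bound[OF assms(2,3), of u i s] by (simp add: sum_distrib_right)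
        \<comment> \<open>Both \<open>sat S i 1\<close> and \<open>u s $ i\<close> are negative, so
          passing to the infimum of the self-weights and to the supremum of the decay can only
          increase the upper bound.\<close>
        moreover have "(\<Sum>l\<in>UNIV. weight S i i l s) * sat S i 1 \<le> self_inf S i * sat S i 1"
          using self B(3) by (intro mult_right_mono_neg) auto
        moreover have "u s $ i < 0"
          using below[of s] s \<open>0 \<le> r\<close> divide_neg_pos[OF B(1) gain[of i]] by simp
        then have "?C * u s $ i \<le> decay S i s * u s $ i"
          using decay by (intro mult_right_mono_neg) auto
        ultimately show "gnn_rhs S u i s \<le> ?C * (\<beta> i - u s $ i)"
          using beta(2) input(1)[of i s] by (simp add: right_diff_distrib)
      qed
      then show ?thesis
        using 1 shift \<open>0 \<le> t\<close> by (auto simp: K1_def r_def)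
    next
      case 2
      have alpha: "ell S i 2 / gain S i < \<alpha> i"
        "- ?C * \<alpha> i + self_inf S i * sat S i 2 - cross_bound S i + (INF t. input S i t) = 0"
        using assms(8)[OF 2] B(6) gain[of i]
        unfolding is_alpha_def F_def by (auto simp: field_simps)
      \<comment> \<open>Reflection: the upper barrier lemma is applied to the negated component,
        with threshold \<open>- (ell S i 2 / gain S i)\<close>.\<close>
      have "- u x $ i \<le> - \<alpha> i" if "- r \<le> x" for x
      proof (rule delayed_barrier[OF \<open>0 \<le> r\<close> continuous_on_minus[OF cont] _ _
            DERIV_minus[OF deriv] _ that])
        show "- \<alpha> i < - (ell S i 2 / gain S i)" using alpha(1) by simp
        show "- u s $ i \<le> - \<alpha> i" if "s \<in> {- r..0}" for s
          using init[OF that, of i] 2 by simp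
        fix s :: real
        assume s: "0 < s" and "\<And>x. x \<in> {- r..s} \<Longrightarrow> - u x $ i < - (ell S i 2 / gain S i)"
        then have above: "ell S i 2 / gain S i < u x $ i" if "x \<in> {- r..s}" for x
          using that by fastforce
        have "act S i (gain S i * u (s - delay S i i l s) $ i) = sat S i 2" for l
          using above[of "s - delay S i i l s"] delay[of i i l s] s gain[of i]
          by (intro B) (auto simp: field_simps)
        then have "- gnn_rhs S u i s \<le> decay S i s * u s $ i
            - (\<Sum>l\<in>UNIV. weight S i i l s) * sat S i 2 - input S i s + cross_bound S i"
          using gnn_rhs_bound[OF assms(2,3), of u i s] by (simp add: sum_distrib_right)
        \<comment> \<open>Here \<open>sat S i 2\<close> and \<open>u s $ i\<close> are positive and
          the right-hand side is negated, so the same two replacements again enlarge the upper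
          bound.\<close>
        moreover have "self_inf S i * sat S i 2 \<le> (\<Sum>l\<in>UNIV. weight S i i l s) * sat S i 2"
          using self B(4) by (intro mult_right_mono) auto
        moreover have "0 < u s $ i"
          using above[of s] s \<open>0 \<le> r\<close> divide_pos_pos[OF B(2) gain[of i]] by simp
        then have "decay S i s * u s $ i \<le> ?C * u s $ i"
          using decay by (intro mult_right_mono) auto
        ultimately show "- gnn_rhs S u i s \<le> ?C * (- \<alpha> i - - u s $ i)"
          using alpha(2) input(2)[of i s] by (simp add: right_diff_distrib)
      qed
      then show ?thesis
        using 2 shift \<open>0 \<le> t\<close> by (auto simp: K2_def r_def)
    qed
  qed
  then show "(\<lambda>s. u (t + s)) \<in> K_Sigma S \<beta> \<alpha> sig"
    unfolding K_Sigma_def by simp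
qed

end
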